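(* Let $ABC$ be a nondegenerate triangle in the Euclidean plane and let $K$ be any metric matrix of $ABC$. For any four points $P,Q,R,T$ in the plane, identified with their normalized barycentric coordinate row vectors with respect to $ABC$, $$\overrightarrow{PQ}\cdot\overrightarrow{RT}=(Q-P)\,K\,(T-R)^T,$$ where the left-hand side is the Euclidean inner product of vectors.
   Context: Write $A=(x_A,y_A)$, $B=(x_B,y_B)$, $C=(x_C,y_C)$ in Cartesian coordinates. The normalized barycentric coordinates of a point $P=(x_P,y_P)$ with respect to $ABC$ are the unique row vector $P=[\alpha_P\ \beta_P\ \gamma_P]$ with $\alpha_P+\beta_P+\gamma_P=1$, $x_A\alpha_P+x_B\beta_P+x_C\gamma_P=x_P$ and $y_A\alpha_P+y_B\beta_P+y_C\gamma_P=y_P$. The same letter denotes a point and its barycentric row vector. Let $\mathbf S=\begin{bmatrix}x_A&x_B&x_C\\ y_A&y_B&y_C\\ 1&1&1\end{bmatrix}$, and for real numbers $m,n,l$ let $$f(m,n,l)=\frac12\begin{bmatrix}2m&m+n&m+l\\ m+n&2n&n+l\\ m+l&n+l&2l\end{bmatrix}.$$ A metric matrix of $ABC$ is any matrix of the form $\mathbf S^T\mathbf S+f(m,n,l)$ with $m,n,l\in\mathbb R$. (For example, $\mathrm{diag}(S_A,S_B,S_C)$ with $S_A=\frac12(b^2+c^2-a^2)$, $S_B=\frac12(c^2+a^2-b^2)$, $S_C=\frac12(a^2+b^2-c^2)$, where $a=|BC|$, $b=|CA|$, $c=|AB|$, is a metric matrix.) *)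

theory Defs
  imports "HOL-Analysis.Analysis"
begin

text \<open>Points of the plane have type \<^typ>\<open>real^2\<close>; row vectors with three entries are
  \<open>1 \<times> 3\<close> matrices, i.e. have type \<^typ>\<open>real^3^1\<close>.\<close>

definition is_barycentric :: "real^2 \<Rightarrow> real^2 \<Rightarrow> real^2 \<Rightarrow> real^2 \<Rightarrow> real^3^1 \<Rightarrow> bool" where
  "is_barycentric A B C P u \<longleftrightarrow>
     u$1$1 + u$1$2 + u$1$3 = 1 \<and>
     A$1 * u$1$1 + B$1 * u$1$2 + C$1 * u$1$3 = P$1 \<and>
     A$2 * u$1$1 + B$2 * u$1$2 + C$2 * u$1$3 = P$2"

text \<open>Meaningful only for noncollinear \<open>A\<close>, \<open>B\<close>, \<open>C\<close>; see \<open>is_barycentric_ex1\<close> below.\<close>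

definition barycentric :: "real^2 \<Rightarrow> real^2 \<Rightarrow> real^2 \<Rightarrow> real^2 \<Rightarrow> real^3^1" where
  "barycentric A B C P = (THE u. is_barycentric A B C P u)"

definition coord_matrix :: "real^2 \<Rightarrow> real^2 \<Rightarrow> real^2 \<Rightarrow> real^3^3" where
  "coord_matrix A B C = vector [
     vector [A$1, B$1, C$1],
     vector [A$2, B$2, C$2],
     vector [1, 1, 1]]"

definition f_matrix :: "real \<Rightarrow> real \<Rightarrow> real \<Rightarrow> real^3^3" where
  "f_matrix m n l = (1/2) *\<^sub>R vector [
     vector [2 * m, m + n, m + l],
     vector [m + n, 2 * n, n + l],
     vector [m + l, n + l, 2 * l]]"

definition metric_matrix :: "real^2 \<Rightarrow> real^2 \<Rightarrow> real^2 \<Rightarrow> real^3^3 \<Rightarrow> bool" where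
  "metric_matrix A B C K \<longleftrightarrow>
     (\<exists>m n l. K = transpose (coord_matrix A B C) ** coord_matrix A B C + f_matrix m n l)"

lemma noncollinear_imp_area_nonzero:
  fixes A B C :: "real^2"
  assumes "\<not> collinear {A, B, C}"
  shows "(B$1 - A$1) * (C$2 - A$2) - (C$1 - A$1) * (B$2 - A$2) \<noteq> 0"
proof
  assume D: "(B$1 - A$1) * (C$2 - A$2) - (C$1 - A$1) * (B$2 - A$2) = 0"
  have ne: "B \<noteq> A" using assms by auto
  have "\<exists>c. C - A = c *\<^sub>R (B - A)"
  proof (cases "B$1 = A$1")
    case True
    then have "B$2 \<noteq> A$2" using ne by (auto simp: vec_eq_iff forall_2)
    then have "C - A = ((C$2 - A$2) / (B$2 - A$2)) *\<^sub>R (B - A)"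
      using D True by (auto simp: vec_eq_iff forall_2)
    then show ?thesis by blast
  next
    case False
    then have "C - A = ((C$1 - A$1) / (B$1 - A$1)) *\<^sub>R (B - A)"
      using D False by (simp add: vec_eq_iff forall_2 nonzero_eq_divide_eq mult.commute)
    then show ?thesis by blast
  qed
  then obtain c where "C - A = c *\<^sub>R (B - A)" by blast
  then have "C = c *\<^sub>R B + (1 - c) *\<^sub>R A" by (simp add: algebra_simps)
  then have "collinear {B, C, A}" by (auto simp: collinear_3_expand)
  then show False using assms by (simp add: insert_commute)
qed

lemma is_barycentric_ex1:
  assumes "\<not> collinear {A, B, C}"
  shows "\<exists>!u. is_barycentric A B C P u"
proof -
  define D where "D = (B$1 - A$1) * (C$2 - A$2) - (C$1 - A$1) * (B$2 - A$2)"
  define b where "b = ((P$1 - A$1) * (C$2 - A$2) - (C$1 - A$1) * (P$2 - A$2)) / D"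
  define c where "c = ((B$1 - A$1) * (P$2 - A$2) - (P$1 - A$1) * (B$2 - A$2)) / D"
  have D: "D \<noteq> 0" using noncollinear_imp_area_nonzero[OF assms] by (simp add: D_def)
  have bD: "b * D = (P$1 - A$1) * (C$2 - A$2) - (C$1 - A$1) * (P$2 - A$2)"
    and cD: "c * D = (B$1 - A$1) * (P$2 - A$2) - (P$1 - A$1) * (B$2 - A$2)"
    using D by (simp_all add: b_def c_def)
  have 1: "A$1 * (1 - b - c) + B$1 * b + C$1 * c = P$1"
  proof -
    have "D * (A$1 * (1 - b - c) + B$1 * b + C$1 * c)
        = D * A$1 + (B$1 - A$1) * (b * D) + (C$1 - A$1) * (c * D)" by algebra
    also have "\<dots> = D * P$1" unfolding bD cD unfolding D_def by algebra
    finally show ?thesis using D by simp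
  qed
  have 2: "A$2 * (1 - b - c) + B$2 * b + C$2 * c = P$2"
  proof -
    have "D * (A$2 * (1 - b - c) + B$2 * b + C$2 * c)
        = D * A$2 + (B$2 - A$2) * (b * D) + (C$2 - A$2) * (c * D)" by algebra
    also have "\<dots> = D * P$2" unfolding bD cD unfolding D_def by algebra
    finally show ?thesis using D by simp
  qed
  show ?thesis
  proof (rule ex1I)
    show "is_barycentric A B C P (vector [vector [1 - b - c, b, c]])"
      using 1 2 by (simp add: is_barycentric_def)
  next
    fix u assume u: "is_barycentric A B C P u"
    then have u1: "u$1$1 = 1 - u$1$2 - u$1$3" by (simp add: is_barycentric_def)
    have e1: "(B$1 - A$1) * u$1$2 + (C$1 - A$1) * u$1$3 = P$1 - A$1"
      and e2: "(B$2 - A$2) * u$1$2 + (C$2 - A$2) * u$1$3 = P$2 - A$2"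
      using u unfolding is_barycentric_def u1 by (auto simp: algebra_simps)
    have "u$1$2 * D = b * D" unfolding bD e1[symmetric] e2[symmetric] unfolding D_def by algebra
    moreover have "u$1$3 * D = c * D" unfolding cD e1[symmetric] e2[symmetric] unfolding D_def by algebra
    ultimately have "u$1$2 = b" "u$1$3 = c" using D by simp_all
    then show "u = vector [vector [1 - b - c, b, c]]"
      using u1 by (simp add: vec_eq_iff forall_3 forall_1)
  qed
qed

lemma is_barycentric_barycentric:
  assumes "\<not> collinear {A, B, C}"
  shows "is_barycentric A B C P (barycentric A B C P)"
  unfolding barycentric_def by (rule theI'[OF is_barycentric_ex1[OF assms]])

end

theory Submission
  imports Defs
begin

text \<open>The matrix \<open>S = coord_matrix A B C\<close> turns a barycentric row vector \<open>u\<close> of a point \<open>P\<close> into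
  the homogeneous coordinates \<open>S u\<^sup>T = (P$1, P$2, 1)\<close>. Hence a difference of two barycentric
  vectors is sent to a displacement with third coordinate \<open>0\<close>, and the form \<open>u (S\<^sup>T S) v\<^sup>T\<close>, which
  is the inner product of \<open>S u\<^sup>T\<close> and \<open>S v\<^sup>T\<close> in three-space, becomes the inner product
  of the plane on such differences (\<open>gram_form\<close>, \<open>barycentric_diff\<close>).

  The freedom in the metric matrix is harmless: with \<open>w = (m, n, l)\<close> and \<open>e = (1, 1, 1)\<close> one has
  \<open>f_matrix m n l = (w\<^sup>T e + e\<^sup>T w) / 2\<close>, so each term of its bilinear form carries the coordinate
  sum of one of the two arguments (\<open>f_matrix_form\<close>), and differences of normalized vectors have
  coordinate sum \<open>0\<close>.\<close>

lemma bilinear_form_add: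
  fixes u v :: "real^3^1" and M N :: "real^3^3"
  shows "(u ** (M + N) ** transpose v)$1$1
    = (u ** M ** transpose v)$1$1 + (u ** N ** transpose v)$1$1"
  by (simp add: matrix_matrix_mult_def transpose_def sum_3 algebra_simps)

lemma gram_form:
  fixes u v :: "real^3^1"
  shows "(u ** (transpose (coord_matrix A B C) ** coord_matrix A B C) ** transpose v)$1$1
    = (A$1 * u$1$1 + B$1 * u$1$2 + C$1 * u$1$3) * (A$1 * v$1$1 + B$1 * v$1$2 + C$1 * v$1$3)
    + (A$2 * u$1$1 + B$2 * u$1$2 + C$2 * u$1$3) * (A$2 * v$1$1 + B$2 * v$1$2 + C$2 * v$1$3)
    + (u$1$1 + u$1$2 + u$1$3) * (v$1$1 + v$1$2 + v$1$3)"
  by (simp add: coord_matrix_def matrix_matrix_mult_def transpose_def sum_3 algebra_simps)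

text \<open>This is the decomposition of \<open>f_matrix m n l\<close> as a symmetrized product of \<open>(m, n, l)\<close> with the
  all-ones vector, read off on the bilinear form.\<close>

lemma f_matrix_form:
  fixes u v :: "real^3^1"
  shows "(u ** f_matrix m n l ** transpose v)$1$1
    = ((m * u$1$1 + n * u$1$2 + l * u$1$3) * (v$1$1 + v$1$2 + v$1$3)
     + (u$1$1 + u$1$2 + u$1$3) * (m * v$1$1 + n * v$1$2 + l * v$1$3)) / 2"
  by (simp add: f_matrix_def matrix_matrix_mult_def transpose_def sum_3 field_simps)

lemma barycentric_diff:
  fixes A B C P Q :: "real^2"
  assumes "\<not> collinear {A, B, C}"
  defines "u \<equiv> barycentric A B C Q - barycentric A B C P"
  shows "u$1$1 + u$1$2 + u$1$3 = 0"
    and "A$1 * u$1$1 + B$1 * u$1$2 + C$1 * u$1$3 = (Q - P)$1"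
    and "A$2 * u$1$1 + B$2 * u$1$2 + C$2 * u$1$3 = (Q - P)$2"
  using is_barycentric_barycentric[OF assms(1), of P] is_barycentric_barycentric[OF assms(1), of Q]
  by (simp_all add: u_def is_barycentric_def algebra_simps)

theorem theorem1:
  fixes A B C P Q R T :: "real^2" and K :: "real^3^3"
  assumes "\<not> collinear {A, B, C}"
    and "metric_matrix A B C K"
  shows "(Q - P) \<bullet> (T - R) =
    ((barycentric A B C Q - barycentric A B C P) ** K **
      transpose (barycentric A B C T - barycentric A B C R)) $ 1 $ 1"
proof -
  obtain m n l where
    K: "K = transpose (coord_matrix A B C) ** coord_matrix A B C + f_matrix m n l"
    using assms(2) unfolding metric_matrix_def by blast
  show ?thesis
    unfolding K bilinear_form_add gram_form f_matrix_form barycentric_diff[OF assms(1)]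
    by (simp add: inner_vec_def sum_2)
qed

end
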